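(* Let $k\ge 3$ be an odd integer and let $n\ge 4k-8$ be an integer. Then for every tree $T_n$ on $n$ vertices, $r(T_n,C_k)=2n-1$.
   Context: All graphs are finite and simple. For graphs $H_1,H_2$, the Ramsey number $r(H_1,H_2)$ is the smallest positive integer $N$ such that every graph $\Gamma$ on $N$ vertices contains $H_1$ as a (not necessarily induced) subgraph or its complement $\overline{\Gamma}$ contains $H_2$ as a subgraph. $C_k$ is the cycle on $k$ vertices. *)

theory Defs
  imports Main
begin

datatype 'a ugraph = UGraph (verts: "'a set") (edges: "'a set set")

definition all_pairs :: "'a set \<Rightarrow> 'a set set" where
  "all_pairs V = {{u, v} | u v. u \<in> V \<and> v \<in> V \<and> u \<noteq> v}"

definition simple_graph :: "'a ugraph \<Rightarrow> bool" where
  "simple_graph G \<longleftrightarrow> finite (verts G) \<and> edges G \<subseteq> all_pairs (verts G)"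

definition complement_graph :: "'a ugraph \<Rightarrow> 'a ugraph" where
  "complement_graph G = UGraph (verts G) (all_pairs (verts G) - edges G)"

text \<open>Containment of a copy of \<open>H\<close> in \<open>G\<close> as a not necessarily induced subgraph; the vertex
  types may differ.\<close>

definition contains_subgraph :: "'b ugraph \<Rightarrow> 'a ugraph \<Rightarrow> bool" where
  "contains_subgraph G H \<longleftrightarrow>
     (\<exists>f. inj_on f (verts H) \<and> f ` verts H \<subseteq> verts G \<and> (\<forall>e\<in>edges H. f ` e \<in> edges G))"

text \<open>Meaningful only for \<open>k \<ge> 3\<close>.\<close>

definition cycle_graph :: "nat \<Rightarrow> nat ugraph" where
  "cycle_graph k = UGraph {..<k} {{i, Suc i mod k} | i. i < k}"

definition connected_graph :: "'a ugraph \<Rightarrow> bool" where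
  "connected_graph G \<longleftrightarrow> verts G \<noteq> {} \<and>
     (\<forall>u\<in>verts G. \<forall>v\<in>verts G. (\<lambda>x y. {x, y} \<in> edges G)\<^sup>*\<^sup>* u v)"

definition acyclic_graph :: "'a ugraph \<Rightarrow> bool" where
  "acyclic_graph G \<longleftrightarrow> (\<forall>m\<ge>3. \<not> contains_subgraph G (cycle_graph m))"

definition tree_graph :: "'a ugraph \<Rightarrow> bool" where
  "tree_graph G \<longleftrightarrow> simple_graph G \<and> connected_graph G \<and> acyclic_graph G"

text \<open>A definition cannot quantify over types, so the host graphs have natural numbers as vertices;
  every finite graph is isomorphic to one of these. By Ramsey's theorem the set over which
  the minimum is taken is nonempty for finite \<open>H1\<close> and \<open>H2\<close>.\<close>

definition ramsey_number :: "'a ugraph \<Rightarrow> 'b ugraph \<Rightarrow> nat" where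
  "ramsey_number H1 H2 =
     (LEAST N. N > 0 \<and>
        (\<forall>\<Gamma> :: nat ugraph. simple_graph \<Gamma> \<and> card (verts \<Gamma>) = N \<longrightarrow>
           contains_subgraph \<Gamma> H1 \<or> contains_subgraph (complement_graph \<Gamma>) H2))"

lemma simple_graph_cycle_graph:
  assumes "k \<ge> 3"
  shows "simple_graph (cycle_graph k)"
proof -
  have "i \<noteq> Suc i mod k" if "i < k" for i
    using assms that by (cases "Suc i = k") auto
  then show ?thesis
    using assms unfolding simple_graph_def cycle_graph_def all_pairs_def
    by fastforce
qed

lemma simple_graph_complement_graph:
  "simple_graph G \<Longrightarrow> simple_graph (complement_graph G)"
  by (auto simp: simple_graph_def complement_graph_def)

end

theory Submission
  imports Defs
begin

text \<open>The lower bound comes from two disjoint red cliques of order \<open>n - 1\<close>.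

  For the upper bound write \<open>k = 2 s + 1\<close>, call the edges of \<open>\<Gamma>\<close> red and the others blue, and
  suppose that there is neither a red \<open>T\<close> nor a blue \<open>C\<^sub>k\<close> on \<open>2 n - 1\<close> vertices. A red graph of
  minimum degree \<open>n - 1\<close> contains \<open>T\<close>, so every vertex set \<open>S\<close> with at least \<open>n\<close> elements has a
  vertex with at least \<open>|S| - n + 1\<close> blue neighbours in \<open>S\<close>. This yields \<open>2 s - 1\<close> hubs, each
  with at least \<open>n - 2 s + 2\<close> blue neighbours outside the set of hubs. Among any three hubs two have
  \<open>s + 1\<close> common neighbours, so some \<open>s\<close> hubs form a chain in which consecutive hubs do. As blue
  \<open>C\<^sub>k\<close> is absent, the blue neighbourhoods of the two ends of the chain are completely joined in
  red, and since there is no red \<open>T\<close> their union has fewer than \<open>n\<close> elements, so they overlap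
  heavily. Rearranging the chain shows that any two of its \<open>s\<close> hubs overlap heavily.

  The common neighbourhood \<open>Y\<close> of two of these hubs is a red clique of more than \<open>n / 2\<close> vertices.
  The vertices without blue neighbours in \<open>Y\<close> are red-complete to \<open>Y\<close>, so together with \<open>Y\<close> they
  are fewer than \<open>n\<close>. Two vertices with distinct blue neighbours in \<open>Y\<close> must be joined in red,
  which makes the red graph on the at least \<open>n\<close> remaining vertices so dense that it
  contains \<open>T\<close>.\<close>

section \<open>Embedding the tree in red\<close>

text \<open>\<open>R\<close> is the red adjacency. The tree lives on \<open>{..<n}\<close> with root \<open>0\<close> and edges joining
  \<open>i > 0\<close> to \<open>par i\<close>; \<open>col\<close> marks its smaller colour class.\<close>

locale tree_cycle =
  fixes V :: "'v set" and R :: "'v \<Rightarrow> 'v \<Rightarrow> bool"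
    and n s :: nat and par :: "nat \<Rightarrow> nat" and col :: "nat \<Rightarrow> bool"
  assumes fin_V: "finite V" and card_V: "card V = 2 * n - 1"
    and sym_R: "\<And>x y. R x y \<Longrightarrow> R y x"
    and s_pos: "s \<ge> 1" and n_large: "n + 4 \<ge> 8 * s"
    and par_less: "\<And>i. 0 < i \<Longrightarrow> i < n \<Longrightarrow> par i < i"
    and col_par: "\<And>i. 0 < i \<Longrightarrow> i < n \<Longrightarrow> col i \<noteq> col (par i)"
    and col_small: "2 * card {i. i < n \<and> col i} \<le> n"
    and no_tree: "\<And>g. inj_on g {..<n} \<Longrightarrow> g ` {..<n} \<subseteq> V \<Longrightarrow>
      (\<And>i. 0 < i \<Longrightarrow> i < n \<Longrightarrow> R (g i) (g (par i))) \<Longrightarrow> False"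
    and no_cycle: "\<And>xs. set xs \<subseteq> V \<Longrightarrow> distinct xs \<Longrightarrow> length xs = 2 * s + 1 \<Longrightarrow>
      successively (\<lambda>x y. x \<noteq> y \<and> \<not> R x y) xs \<Longrightarrow> \<not> R (last xs) (hd xs) \<Longrightarrow> False"
begin

abbreviation "B x y \<equiv> x \<noteq> y \<and> \<not> R x y"
abbreviation "a \<equiv> card {i. i < n \<and> col i}"
abbreviation "b \<equiv> card {i. i < n \<and> \<not> col i}"

lemma fin_sub: "X \<subseteq> V \<Longrightarrow> finite X"
  using fin_V finite_subset by blast

lemma class_sum: "a + b = n"
proof -
  have "a + b = card ({i. i < n \<and> col i} \<union> {i. i < n \<and> \<not> col i})"
    by (subst card_Un_disjoint) auto
  also have "{i. i < n \<and> col i} \<union> {i. i < n \<and> \<not> col i} = {..<n}" by auto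
  finally show ?thesis by simp
qed

lemma exists_outside: "finite Y \<Longrightarrow> card Y < card X \<Longrightarrow> \<exists>z. z \<in> X \<and> z \<notin> Y"
  by (meson card_mono leD subsetI)

text \<open>The tree is embedded greedily; vertices of the other colour class occupy \<open>P\<close> as long as
  \<open>P\<close> has room, so that they do not use up \<open>W\<close>.\<close>

lemma tree_in_join:
  assumes "W \<subseteq> V" "P \<subseteq> V" "W \<inter> P = {}"
    and join: "\<And>w p. w \<in> W \<Longrightarrow> p \<in> P \<Longrightarrow> R w p"
    and deg: "\<And>w. w \<in> W \<Longrightarrow> n \<le> card {z \<in> W \<union> P. z \<noteq> w \<and> R w z} + 1"
    and size: "n \<le> card (W \<union> P)" and W_size: "a \<le> card W"
  shows False
proof -
  have fin: "finite W" "finite P" using assms fin_sub by auto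
  have "\<exists>g. inj_on g {..<m} \<and> g ` {..<m} \<subseteq> W \<union> P \<and> (\<forall>i<m. col i \<longrightarrow> g i \<in> W)
      \<and> (\<forall>i<m. 0 < i \<longrightarrow> R (g i) (g (par i)))
      \<and> (P \<subseteq> g ` {..<m} \<or> (\<forall>i<m. \<not> col i \<longrightarrow> g i \<in> P))" if "m \<le> n" for m
    using that
  proof (induction m)
    case 0
    then show ?case by auto
  next
    case (Suc m)
    then obtain g where g: "inj_on g {..<m}" "g ` {..<m} \<subseteq> W \<union> P" "\<forall>i<m. col i \<longrightarrow> g i \<in> W"
      "\<forall>i<m. 0 < i \<longrightarrow> R (g i) (g (par i))"
      "P \<subseteq> g ` {..<m} \<or> (\<forall>i<m. \<not> col i \<longrightarrow> g i \<in> P)" by auto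
    let ?I = "g ` {..<m}"
    have m: "m < n" and cI: "card ?I = m" using Suc.prems g(1) by (auto simp: card_image)
    have par: "par m < m" "col m \<noteq> col (par m)" if "0 < m" using par_less col_par m that by auto
    have pW: "g (par m) \<in> W" if "0 < m" "\<not> col m" using par g(3) that by auto
    have "\<exists>z. z \<in> W \<union> P \<and> z \<notin> ?I \<and> (col m \<longrightarrow> z \<in> W) \<and> (0 < m \<longrightarrow> R z (g (par m)))
        \<and> (P \<subseteq> ?I \<or> (\<not> col m \<longrightarrow> z \<in> P))"
    proof (cases "P \<subseteq> ?I")
      case True
      obtain z0 where z0: "z0 \<in> W \<union> P" "z0 \<notin> ?I"
        using exists_outside[of ?I "W \<union> P"] cI m size by auto
      show ?thesis
      proof (cases "0 < m \<and> g (par m) \<in> W")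
        case mW: True
        let ?x = "g (par m)"
        have "?x \<in> ?I" using par mW by auto
        then have "card (?I - {?x}) = m - 1" using cI by simp
        then have "card (?I - {?x}) < card {z \<in> W \<union> P. z \<noteq> ?x \<and> R ?x z}"
          using deg[of ?x] mW m by linarith
        then obtain z where "z \<in> W \<union> P" "z \<noteq> ?x" "R ?x z" "z \<notin> ?I"
          using exists_outside[of "?I - {?x}"] by blast
        then show ?thesis using True sym_R by blast
      next
        case False
        \<comment> \<open>With \<open>P\<close> used up, every free vertex lies in \<open>W\<close>
          and is red to a parent in \<open>P\<close>, so the spare \<open>z0\<close> serves; for
          \<open>m = 0\<close> there is no parent to respect.\<close>
        have "g (par m) \<in> P" if "0 < m" using False that g(2) par by blast
        then show ?thesis using z0 True join by blast
      qed
    next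
      case False
      then have bP: "\<forall>i<m. \<not> col i \<longrightarrow> g i \<in> P" using g(5) by auto
      show ?thesis
      proof (cases "col m")
        case True
        \<comment> \<open>While \<open>P\<close> has room, only vertices of the class
          \<open>col\<close> sit in \<open>W\<close>, so \<open>a\<close> places there are
          enough.\<close>
        have "?I \<inter> W \<subseteq> g ` {i. i < m \<and> col i}" using bP assms(3) by auto
        then have "card (?I \<inter> W) \<le> card (g ` {i. i < m \<and> col i})" by (rule card_mono[rotated]) auto
        also have "\<dots> \<le> card {i. i < m \<and> col i}" by (rule card_image_le) auto
        also have "\<dots> < a" by (rule psubset_card_mono) (use m True in auto)
        finally have "card (?I \<inter> W) < card W" using W_size by simp
        then obtain z where "z \<in> W" "z \<notin> ?I" using exists_outside[of "?I \<inter> W" W] by auto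
        then show ?thesis using True join bP par by blast
      next
        case False
        then show ?thesis using \<open>\<not> P \<subseteq> ?I\<close> join[OF pW] sym_R by blast
      qed
    qed
    then obtain z where z: "z \<in> W \<union> P" "z \<notin> ?I" "col m \<longrightarrow> z \<in> W" "0 < m \<longrightarrow> R z (g (par m))"
      "P \<subseteq> ?I \<or> (\<not> col m \<longrightarrow> z \<in> P)" by blast
    let ?g = "g(m := z)"
    have im: "?g ` {..<Suc m} = insert z ?I" by (auto simp: lessThan_Suc)
    have "inj_on ?g {..<Suc m}" using g(1) z(2) by (auto simp: lessThan_Suc inj_on_def)
    moreover have "\<forall>i<Suc m. 0 < i \<longrightarrow> R (?g i) (?g (par i))"
    proof (intro allI impI)
      fix i assume i: "i < Suc m" "0 < i"
      then have "par i < i" using par_less m by auto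
      then show "R (?g i) (?g (par i))" using i g(4) z(4) by (cases "i = m") auto
    qed
    moreover have "\<forall>i<Suc m. col i \<longrightarrow> ?g i \<in> W" using g(3) z(3) by (auto simp: less_Suc_eq)
    moreover have "P \<subseteq> insert z ?I \<or> (\<forall>i<Suc m. \<not> col i \<longrightarrow> ?g i \<in> P)"
      using g(5) z(5) by (auto simp: less_Suc_eq)
    moreover have "?g ` {..<Suc m} \<subseteq> W \<union> P" unfolding im using g(2) z(1) by auto
    ultimately show ?case unfolding im[symmetric] by blast
  qed
  from this[of n] obtain g where "inj_on g {..<n}" "g ` {..<n} \<subseteq> W \<union> P"
      "\<forall>i<n. 0 < i \<longrightarrow> R (g i) (g (par i))" by auto
  then show False using no_tree[of g] assms(1,2) by blast
qed

text \<open>A vertex of \<open>X\<close> is red to all other vertices of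
  \<open>X \<union> Z\<close>, so the degree condition of \<open>tree_in_join\<close> becomes a mere
  count of vertices.\<close>

lemma tree_in_clique_join:
  assumes "X \<subseteq> V" "Z \<subseteq> V" "X \<inter> Z = {}" "n \<le> card X + card Z" "a \<le> card X"
    and R: "\<And>x y. x \<in> X \<Longrightarrow> y \<in> X \<union> Z \<Longrightarrow> x \<noteq> y \<Longrightarrow> R x y"
  shows False
proof (rule tree_in_join[of X Z])
  have fin: "finite X" "finite Z" using assms fin_sub by auto
  then show n: "n \<le> card (X \<union> Z)" using assms(3,4) by (simp add: card_Un_disjoint)
  fix w assume w: "w \<in> X"
  then have "{z \<in> X \<union> Z. z \<noteq> w \<and> R w z} = (X \<union> Z) - {w}" using R by blast
  then show "n \<le> card {z \<in> X \<union> Z. z \<noteq> w \<and> R w z} + 1" using n w fin by simp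
next
  show "R w p" if "w \<in> X" "p \<in> Z" for w p using that R assms(3) by blast
qed (use assms in auto)

text \<open>Tree edges join different colour classes, so any two injections of the classes into the
  two sides fit together.\<close>

lemma tree_in_bipartite:
  assumes "X \<subseteq> V" "Y \<subseteq> V" "X \<inter> Y = {}" "a \<le> card X" "b \<le> card Y"
    and join: "\<And>x y. x \<in> X \<Longrightarrow> y \<in> Y \<Longrightarrow> R x y"
  shows False
proof -
  obtain f where f: "inj_on f {i. i < n \<and> col i}" "f ` {i. i < n \<and> col i} \<subseteq> X"
    using card_le_inj[of "{i. i < n \<and> col i}" X] assms fin_sub by auto
  obtain h where h: "inj_on h {i. i < n \<and> \<not> col i}" "h ` {i. i < n \<and> \<not> col i} \<subseteq> Y"
    using card_le_inj[of "{i. i < n \<and> \<not> col i}" Y] assms fin_sub by auto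
  define g where "g i = (if col i then f i else h i)" for i
  have gc: "g i \<in> X" if "i < n" "col i" for i using f that by (auto simp: g_def)
  have gn: "g i \<in> Y" if "i < n" "\<not> col i" for i using h that by (auto simp: g_def)
  have "inj_on g {..<n}"
  proof (rule inj_onI)
    fix i j assume "i \<in> {..<n}" "j \<in> {..<n}" "g i = g j"
    then show "i = j"
      using gc[of i] gc[of j] gn[of i] gn[of j] assms(3) inj_onD[OF f(1), of i j] inj_onD[OF h(1), of i j]
      by (cases "col i"; cases "col j") (auto simp: g_def)
  qed
  moreover have "g ` {..<n} \<subseteq> V" using gc gn assms(1,2) by blast
  moreover have "R (g i) (g (par i))" if "0 < i" "i < n" for i
  proof -
    have "par i < n" using par_less[OF that] that by simp
    then show ?thesis
      using col_par[OF that] gc[of i] gn[of i] gc[of "par i"] gn[of "par i"] that join sym_R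
      by (cases "col i") auto
  qed
  ultimately show False using no_tree by blast
qed

section \<open>Vertices of large blue degree\<close>

lemma degenerate:
  assumes "S \<subseteq> V" "n \<le> card S"
  shows "\<exists>v\<in>S. card S + 1 \<le> n + card {z \<in> S. B v z}"
proof (rule ccontr)
  assume neg: "\<not> ?thesis"
  have fin: "finite S" using assms fin_sub by auto
  have "n \<le> card {z \<in> S \<union> {}. z \<noteq> w \<and> R w z} + 1" if "w \<in> S" for w
  proof -
    have "S = insert w ({z \<in> S. z \<noteq> w \<and> R w z} \<union> {z \<in> S. B w z})" using that by auto
    then have "card S = card (insert w ({z \<in> S. z \<noteq> w \<and> R w z} \<union> {z \<in> S. B w z}))" by simp
    also have "\<dots> = Suc (card ({z \<in> S. z \<noteq> w \<and> R w z} \<union> {z \<in> S. B w z}))"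
      using fin by (subst card_insert_disjoint) auto
    also have "\<dots> = Suc (card {z \<in> S. z \<noteq> w \<and> R w z} + card {z \<in> S. B w z})"
      using fin by (subst card_Un_disjoint) auto
    finally show ?thesis using neg that by fastforce
  qed
  then show False using tree_in_join[of S "{}"] assms class_sum by simp
qed

text \<open>Hubs are peeled off one at a time by applying \<open>degenerate\<close> to the remaining
  vertices. An older hub loses at most the new hub as a neighbour, which the growth of
  \<open>j\<close> pays for.\<close>

lemma hub_set:
  assumes "j \<le> n"
  shows "\<exists>H\<subseteq>V. card H = j \<and> (\<forall>h\<in>H. n + 1 \<le> j + card {x \<in> V - H. B h x})"
  using assms
proof (induction j)
  case 0
  then show ?case by (intro exI[of _ "{}"]) auto
next
  case (Suc j)
  then obtain H where H: "H \<subseteq> V" "card H = j" "\<forall>h\<in>H. n + 1 \<le> j + card {x \<in> V - H. B h x}" by auto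
  have fH: "finite H" using H fin_sub by auto
  have c: "card (V - H) = 2 * n - 1 - j" using H card_V fH by (simp add: card_Diff_subset)
  then have "n \<le> card (V - H)" using Suc.prems by linarith
  then obtain v where v: "v \<in> V - H" "card (V - H) + 1 \<le> n + card {z \<in> V - H. B v z}"
    using degenerate[of "V - H"] by blast
  let ?H = "insert v H"
  have "n + 1 \<le> Suc j + card {x \<in> V - ?H. B h x}" if "h \<in> ?H" for h
  proof (cases "h = v")
    case True
    then have "{x \<in> V - ?H. B h x} = {z \<in> V - H. B v z}" by auto
    then show ?thesis using v c Suc.prems by simp
  next
    case False
    have "{x \<in> V - H. B h x} \<subseteq> insert v {x \<in> V - ?H. B h x}" by auto
    then have "card {x \<in> V - H. B h x} \<le> card (insert v {x \<in> V - ?H. B h x})"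
      using fin_V by (intro card_mono) auto
    also have "\<dots> \<le> Suc (card {x \<in> V - ?H. B h x})" by (rule card_insert_le_m1) auto
    finally show ?thesis using H(3) that False by fastforce
  qed
  then show ?case using v H fH by (intro exI[of _ ?H]) auto
qed

section \<open>Completely joined pairs of sets\<close>

text \<open>Depth-first search: \<open>F\<close> is the set of finished vertices, \<open>xs\<close> the current path and \<open>X\<close>
  the set of unvisited vertices.\<close>

lemma dfs_separation:
  assumes "D \<subseteq> V" "f \<le> card D"
  shows "\<exists>F X xs. F \<union> X \<union> set xs = D \<and> F \<inter> X = {} \<and> set xs \<inter> (F \<union> X) = {} \<and> distinct xs
    \<and> successively B xs \<and> card F = f \<and> (\<forall>x\<in>F. \<forall>y\<in>X. R x y)"
  (is "\<exists>F X xs. ?inv f F X xs")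
  using assms(2)
proof (induction f)
  case 0
  show ?case by (intro exI[of _ "{}"] exI[of _ D] exI[of _ "[]"]) auto
next
  case (Suc f)
  then obtain F X xs where "?inv f F X xs" by auto
  then show ?case
  \<comment> \<open>Extending or restarting the path shrinks \<open>X\<close>, so after finitely
    many such moves a vertex gets finished.\<close>
  proof (induction "card X" arbitrary: X xs rule: less_induct)
    case less
    from less.prems have D: "F \<union> X \<union> set xs = D" and FX: "F \<inter> X = {}" and xs: "set xs \<inter> (F \<union> X) = {}"
      and dist: "distinct xs" and succ: "successively B xs" and F: "card F = f"
      and R: "\<forall>x\<in>F. \<forall>y\<in>X. R x y" by blast+
    have fin: "finite F" "finite X" using D assms(1) fin_sub by blast+
    show ?case
    proof (cases xs)
      case Nil
      have "X \<noteq> {}" using D Nil F Suc.prems by auto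
      then obtain u where u: "u \<in> X" by auto
      have "F \<union> (X - {u}) \<union> set [u] = D" using D Nil u by auto
      moreover have "F \<inter> (X - {u}) = {}" "set [u] \<inter> (F \<union> (X - {u})) = {}" using FX u by auto
      moreover have "\<forall>x\<in>F. \<forall>y\<in>X - {u}. R x y" using R by auto
      ultimately show ?thesis
        using less.hyps[OF card_Diff1_less[OF fin(2) u], of "[u]"] F by simp
    next
      case (Cons x ys)
      show ?thesis
      proof (cases "\<exists>u\<in>X. \<not> R x u")
        case True
        then obtain u where u: "u \<in> X" "\<not> R x u" by auto
        have nu: "u \<notin> set xs" using xs u by auto
        have "F \<union> (X - {u}) \<union> set (u # xs) = D" using D u by auto
        moreover have "F \<inter> (X - {u}) = {}" "set (u # xs) \<inter> (F \<union> (X - {u})) = {}"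
          using FX u xs by auto
        moreover have "\<forall>x\<in>F. \<forall>y\<in>X - {u}. R x y" using R by auto
        moreover have "distinct (u # xs)" using nu dist by simp
        moreover have "successively B (u # xs)"
          using succ Cons u(2) nu sym_R[of u x] by (auto simp: successively_Cons)
        ultimately show ?thesis
          using less.hyps[OF card_Diff1_less[OF fin(2) u(1)], of "u # xs"] F by blast
      next
        case False
        \<comment> \<open>The head \<open>x\<close> has no unvisited blue neighbour, hence is red to
          all of \<open>X\<close> and counts as finished.\<close>
        have "insert x F \<union> X \<union> set ys = D" using D Cons by auto
        moreover have "insert x F \<inter> X = {}" "set ys \<inter> (insert x F \<union> X) = {}"
          using FX xs dist Cons by auto
        moreover have "\<forall>z\<in>insert x F. \<forall>y\<in>X. R z y" using R False by auto
        moreover have "distinct ys" "successively B ys"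
          using dist succ Cons by (auto simp: successively_Cons)
        moreover have "card (insert x F) = Suc f" using xs Cons F fin by simp
        ultimately show ?thesis by blast
      qed
    qed
  qed
qed

text \<open>The hub \<open>p\<close> forbids a blue path with \<open>2 s\<close> vertices inside \<open>A\<close>; this is needed for
  trees that are so close to a star that a colour class fits neither into \<open>A\<close> nor into \<open>C\<close>.\<close>

lemma joined_sets_small:
  assumes "A \<subseteq> V" "C \<subseteq> V" and join: "\<And>x y. x \<in> A \<Longrightarrow> y \<in> C \<Longrightarrow> x \<noteq> y \<Longrightarrow> R x y"
    and cA: "n + 2 \<le> card A + 2 * s" and cC: "n + 2 \<le> card C + 2 * s"
    and p: "p \<in> V" "\<And>x. x \<in> A \<Longrightarrow> B p x"
  shows "card (A \<union> C) < n"
proof (rule ccontr)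
  assume "\<not> card (A \<union> C) < n"
  then have union: "n \<le> card (A \<union> C)" by simp
  have fin: "finite A" "finite C" using assms fin_sub by auto
  show False
  proof (cases "a \<le> card (A \<inter> C)")
    case True
    \<comment> \<open>Vertices of the overlap lie on both sides of the join, so the overlap is a red
      clique and red to the whole union.\<close>
    let ?Z = "(A \<union> C) - (A \<inter> C)"
    have un: "(A \<inter> C) \<union> ?Z = A \<union> C" by auto
    show False
    proof (rule tree_in_clique_join[of "A \<inter> C" ?Z])
      show "R x y" if "x \<in> A \<inter> C" "y \<in> A \<inter> C \<union> ?Z" "x \<noteq> y" for x y
        using that join[of x y] join[of y x] sym_R by blast
      have "card ((A \<inter> C) \<union> ?Z) = card (A \<inter> C) + card ?Z"
        using fin by (intro card_Un_disjoint) auto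
      then show "n \<le> card (A \<inter> C) + card ?Z" using union un by simp
    qed (use assms(1,2) True in auto)
  next
    case I: False
    have cD: "card A = card (A - C) + card (A \<inter> C)"
      using fin by (metis card_Diff_subset_Int card_mono finite_Int inf_le1 le_add_diff_inverse2)
    show False
    proof (cases "b \<le> card C")
      case True
      have aA: "a \<le> card A" using cA col_small n_large by linarith
      \<comment> \<open>\<open>A0\<close> prefers \<open>A - C\<close>. Either it misses
        \<open>C\<close>, which stays whole, or it contains \<open>A - C\<close>, and then the at
        least \<open>n - a = b\<close> vertices of the union outside \<open>A0\<close> all lie in
        \<open>C\<close>.\<close>
      obtain A0 where A0: "A0 \<subseteq> A" "card A0 = a" "A - C \<subseteq> A0 \<or> A0 \<subseteq> A - C"
      proof (cases "a \<le> card (A - C)")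
        case True
        then obtain A0 where "A0 \<subseteq> A - C" "card A0 = a" by (meson obtain_subset_with_card_n)
        then show ?thesis using that by blast
      next
        case False
        then obtain A0 where "A - C \<subseteq> A0" "A0 \<subseteq> A" "card A0 = a"
          using exists_subset_between[of "A - C" a A] aA fin by auto
        then show ?thesis using that by blast
      qed
      have "b \<le> card (C - A0)"
      proof (cases "A0 \<subseteq> A - C")
        case True
        then have "C - A0 = C" by auto
        then show ?thesis using \<open>b \<le> card C\<close> by simp
      next
        case False
        then have "C - A0 = (A \<union> C) - A0" using A0 by auto
        moreover have "card ((A \<union> C) - A0) = card (A \<union> C) - a"
          using A0 fin by (metis card_Diff_subset finite_subset le_supI1)
        ultimately have "card (C - A0) = card (A \<union> C) - a" by metis
        then show ?thesis using union class_sum by linarith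
      qed
      then show False
        using tree_in_bipartite[of A0 "C - A0"] A0(1,2) assms(1,2) join
        by (metis DiffD1 DiffD2 Diff_disjoint Diff_subset order_refl subset_iff)
    next
      case False
      \<comment> \<open>\<open>C\<close> is \<open>\<delta>\<close> vertices short of hosting the
        larger class. They come from the unvisited part of a depth-first search in
        \<open>A - C\<close>, whose \<open>a\<close> finished vertices host the smaller
        class.\<close>
      define \<delta> where "\<delta> = b - card C"
      have as: "a + 3 \<le> 2 * s" using False cC class_sum by linarith
      have D: "4 * s + 2 \<le> card (A - C)" using cD I cA as n_large by linarith
      obtain F X xs where dfs: "F \<union> X \<union> set xs = A - C" "F \<inter> X = {}" "set xs \<inter> (F \<union> X) = {}"
        "distinct xs" "successively B xs" "card F = a" "\<forall>x\<in>F. \<forall>y\<in>X. R x y"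
      proof -
        have "A - C \<subseteq> V" "a \<le> card (A - C)" using assms(1) D as by auto
        then show ?thesis using dfs_separation[of "A - C" a] that by blast
      qed
      have finFX: "finite F" "finite X" using dfs(1) fin by (auto intro: finite_subset)
      \<comment> \<open>Since \<open>p\<close> is blue to all of \<open>A\<close>, it would close
        \<open>2 * s\<close> vertices of the path into a forbidden blue cycle.\<close>
      have short: "length xs < 2 * s"
      proof (rule ccontr)
        assume l: "\<not> length xs < 2 * s"
        define ys where "ys = take (2 * s) xs"
        have xs: "xs = ys @ drop (2 * s) xs" by (simp add: ys_def)
        have "successively B ys" using dfs(5) xs by (metis successively_append_iff)
        moreover have "set ys \<subseteq> A" using dfs(1) set_take_subset[of "2 * s" xs] by (auto simp: ys_def)
        ultimately have ys: "distinct ys" "successively B ys" "length ys = 2 * s" "set ys \<subseteq> A"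
          using dfs(4) l by (auto simp: ys_def)
        then have ne: "ys \<noteq> []" using s_pos by auto
        have "\<not> R (last (p # ys)) (hd (p # ys))" using ne ys p sym_R last_in_set by fastforce
        moreover have "successively B (p # ys)"
          using ys p ne hd_in_set by (fastforce simp: successively_Cons)
        moreover have "distinct (p # ys)" using ys p by auto
        ultimately show False using no_cycle[of "p # ys"] ys p(1) assms(1) by auto
      qed
      have "card (A - C) = card F + card X + card (set xs)"
      proof -
        have "card (F \<union> X \<union> set xs) = card (F \<union> X) + card (set xs)"
          using dfs(3) finFX by (intro card_Un_disjoint) auto
        then show ?thesis using dfs(1,2) finFX by (simp add: card_Un_disjoint)
      qed
      then have "\<delta> \<le> card X"
        using D as short dfs(4,6) cC class_sum by (simp add: \<delta>_def distinct_card)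
      moreover have "X \<inter> C = {}" using dfs(1) by auto
      ultimately have "b \<le> card (X \<union> C)" using finFX fin by (simp add: card_Un_disjoint \<delta>_def)
      show False
      proof (rule tree_in_bipartite[of F "X \<union> C", rotated -1])
        show "R x y" if "x \<in> F" "y \<in> X \<union> C" for x y
          using that dfs(1,7) join[of x y] by blast
        show "F \<inter> (X \<union> C) = {}" using dfs(1,2) by blast
      qed (use dfs(1,6) assms(1,2) \<open>b \<le> card (X \<union> C)\<close> in auto)
    qed
  qed
qed

end

section \<open>Hubs of the blue graph\<close>

locale hubs = tree_cycle +
  fixes H
  assumes H_sub: "H \<subseteq> V" and card_H: "card H = 2 * s - 1"
    and hub_deg: "\<And>h. h \<in> H \<Longrightarrow> n + 2 \<le> card {x \<in> V - H. h \<noteq> x \<and> \<not> R h x} + 2 * s"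
begin

definition "U h = {x \<in> V - H. B h x}"

text \<open>The threshold \<open>s + 1\<close> serves a greedy choice of connecting vertices along
  \<open>s\<close> hubs: at most \<open>s - 2\<close> earlier choices and two reserved end vertices
  must be avoided.\<close>

definition "sim p q \<longleftrightarrow> p \<noteq> q \<and> s + 1 \<le> card (U p \<inter> U q)"
text \<open>For hubs, whose sets \<open>U\<close> have at least \<open>n + 2 - 2 * s\<close>
  elements, a small union means an overlap of at least \<open>n + 5 - 4 * s\<close>.\<close>

definition "heavy p q \<longleftrightarrow> card (U p \<union> U q) < n"

lemma mem_U: "x \<in> U h \<longleftrightarrow> x \<in> V \<and> x \<notin> H \<and> B h x"
  by (auto simp: U_def)

lemma fin_U: "finite (U h)" "finite H"
  using fin_sub H_sub by (auto simp: U_def)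

lemma card_U: "h \<in> H \<Longrightarrow> n + 2 \<le> card (U h) + 2 * s"
  using hub_deg by (simp add: U_def)

lemma card_U_Un_Int: "card (U p \<union> U q) + card (U p \<inter> U q) = card (U p) + card (U q)"
  using card_Un_Int fin_U by metis

lemma sim_sym: "sim p q \<Longrightarrow> sim q p"
  by (auto simp: sim_def Int_commute)

lemma heavy_sym: "heavy p q \<Longrightarrow> heavy q p"
  by (auto simp: heavy_def Un_commute)

text \<open>Hubs alternate with greedily chosen common neighbours. Each choice adds one vertex to
  the forbidden set \<open>Fb\<close> and drops one hub, so the size condition is inherited
  unchanged.\<close>

lemma hub_path:
  assumes "qs \<noteq> []" "distinct qs" "set qs \<subseteq> H" "finite Fb"
    and "successively (\<lambda>p q. card Fb + length qs \<le> card (U p \<inter> U q) + 1) qs"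
  shows "\<exists>zs. zs \<noteq> [] \<and> hd zs = hd qs \<and> last zs = last qs \<and> length zs + 1 = 2 * length qs
    \<and> distinct zs \<and> set zs \<subseteq> set qs \<union> (V - H - Fb) \<and> successively B zs"
  using assms
proof (induction qs arbitrary: Fb rule: induct_list012)
  case 1
  then show ?case by simp
next
  case (2 q)
  show ?case by (intro exI[of _ "[q]"]) auto
next
  case (3 q r qs)
  have "card Fb < card (U q \<inter> U r)" using "3.prems" by simp
  then obtain c where c: "c \<in> U q \<inter> U r" "c \<notin> Fb"
    using exists_outside "3.prems"(4) by blast
  have "card (insert c Fb) = Suc (card Fb)" using c "3.prems"(4) by simp
  then have "successively (\<lambda>p q. card (insert c Fb) + length (r # qs) \<le> card (U p \<inter> U q) + 1) (r # qs)"
    using "3.prems"(5) by simp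
  then obtain zs where zs: "zs \<noteq> []" "hd zs = r" "last zs = last (r # qs)"
      "length zs + 1 = 2 * length (r # qs)" "distinct zs"
      "set zs \<subseteq> set (r # qs) \<union> (V - H - insert c Fb)" "successively B zs"
    using "3.IH"(2)[of "insert c Fb"] "3.prems" by auto
  have "R x y \<Longrightarrow> R y x" for x y using sym_R by blast
  then have "successively B (q # c # zs)"
    using zs c by (auto simp: successively_Cons mem_U)
  moreover have "distinct (q # c # zs)" using zs(5,6) c "3.prems"(2,3) by (auto simp: mem_U)
  moreover have "set (q # c # zs) \<subseteq> set (q # r # qs) \<union> (V - H - Fb)" using zs(6) c by (auto simp: mem_U)
  ultimately show ?case using zs by (intro exI[of _ "q # c # zs"]) auto
qed

text \<open>A blue edge between \<open>x\<close> and \<open>y\<close> would close the hub path on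
  \<open>2 * s - 1\<close> vertices, extended by \<open>x\<close> and \<open>y\<close>, into a blue
  cycle of length \<open>2 * s + 1\<close>.\<close>

lemma linked_joined:
  assumes "distinct qs" "set qs \<subseteq> H" "length qs = s" "successively sim qs"
    and x: "x \<in> U (hd qs)" and y: "y \<in> U (last qs)" and "x \<noteq> y"
  shows "R x y"
proof (rule ccontr)
  assume nR: "\<not> R x y"
  have "qs \<noteq> []" using assms(3) s_pos by auto
  moreover have "successively (\<lambda>p q. card {x, y} + length qs \<le> card (U p \<inter> U q) + 1) qs"
    by (rule successively_mono[OF assms(4)]) (use assms(3,7) in \<open>auto simp: sim_def\<close>)
  ultimately obtain zs where zs: "zs \<noteq> []" "hd zs = hd qs" "last zs = last qs"
      "length zs + 1 = 2 * length qs" "distinct zs" "set zs \<subseteq> set qs \<union> (V - H - {x, y})"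
      "successively B zs"
    using hub_path[of qs "{x, y}"] assms(1,2) by blast
  have "R u v \<Longrightarrow> R v u" for u v using sym_R by blast
  then have "successively B (x # zs @ [y])"
    using zs x y by (auto simp: successively_Cons successively_append_iff mem_U)
  moreover have "distinct (x # zs @ [y])" "set (x # zs @ [y]) \<subseteq> V"
    using zs(5,6) x y assms(2,7) H_sub by (auto simp: mem_U)
  ultimately show False
    using no_cycle[of "x # zs @ [y]"] zs(4) assms(3) nR sym_R[of y x] by auto
qed

lemma linked_heavy:
  assumes "distinct qs" "set qs \<subseteq> H" "length qs = s" "successively sim qs"
  shows "heavy (hd qs) (last qs)"
  unfolding heavy_def
proof (rule joined_sets_small[where p = "hd qs"])
  have "qs \<noteq> []" using assms(3) s_pos by auto
  then have "hd qs \<in> H" "last qs \<in> H" using assms(2) by auto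
  then show "n + 2 \<le> card (U (hd qs)) + 2 * s" "n + 2 \<le> card (U (last qs)) + 2 * s" "hd qs \<in> V"
    using card_U H_sub by auto
qed (use linked_joined[OF assms] mem_U in auto)

lemma heavy_inter:
  assumes "p \<in> H" "q \<in> H" "heavy p q"
  shows "n + 5 \<le> card (U p \<inter> U q) + 4 * s"
  using card_U_Un_Int[of p q] card_U[OF assms(1)] card_U[OF assms(2)] assms(3)
  unfolding heavy_def by linarith

lemma heavy_sim:
  assumes "p \<in> H" "q \<in> H" "heavy p q" "p \<noteq> q"
  shows "sim p q"
  using heavy_inter[OF assms(1-3)] n_large assms(4) by (simp add: sim_def)

text \<open>Both overlaps lie in \<open>U q\<close>, so \<open>U p\<close> and \<open>U r\<close>
  share at least \<open>|U p| + |U q| + |U r| - 2 * (n - 1)\<close> vertices. This is at least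
  \<open>n + 8 - 6 * s\<close>, more than \<open>s\<close>.\<close>

lemma heavy_heavy_sim:
  assumes "p \<in> H" "q \<in> H" "r \<in> H" "heavy p q" "heavy q r" "p \<noteq> r"
  shows "sim p r"
proof -
  have "card (U p \<inter> U q) + card (U q \<inter> U r)
      = card ((U p \<inter> U q) \<union> (U q \<inter> U r)) + card ((U p \<inter> U q) \<inter> (U q \<inter> U r))"
    by (rule card_Un_Int) (use fin_U in auto)
  moreover have "card ((U p \<inter> U q) \<union> (U q \<inter> U r)) \<le> card (U q)"
    by (rule card_mono) (use fin_U in auto)
  moreover have "card ((U p \<inter> U q) \<inter> (U q \<inter> U r)) \<le> card (U p \<inter> U r)"
    by (rule card_mono) (use fin_U in auto)
  ultimately have "card (U p \<inter> U q) + card (U q \<inter> U r) \<le> card (U q) + card (U p \<inter> U r)"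
    by linarith
  then have "s + 1 \<le> card (U p \<inter> U r)"
    using card_U[OF assms(1)] card_U[OF assms(2)] card_U[OF assms(3)] assms(4,5) n_large
      card_U_Un_Int[of p q] card_U_Un_Int[of q r]
    unfolding heavy_def by linarith
  then show ?thesis using assms(6) by (simp add: sim_def)
qed

text \<open>Three sets of at least \<open>n + 2 - 2 * s\<close> elements with pairwise overlaps of
  at most \<open>s\<close> do not fit into the \<open>2 * n - 2 * s\<close> vertices outside
  \<open>H\<close>.\<close>

lemma sim_of_three:
  assumes "p \<in> H" "q \<in> H" "r \<in> H" "p \<noteq> q" "p \<noteq> r" "q \<noteq> r" "\<not> sim p q" "\<not> sim p r"
  shows "sim q r"
proof (rule ccontr)
  assume "\<not> sim q r"
  then have "card (U p \<inter> U q) \<le> s" "card (U p \<inter> U r) \<le> s" "card (U q \<inter> U r) \<le> s"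
    using assms by (auto simp: sim_def)
  moreover have "card ((U p \<union> U q) \<union> U r) + card ((U p \<union> U q) \<inter> U r) = card (U p \<union> U q) + card (U r)"
    by (rule card_Un_Int[symmetric]) (use fin_U in auto)
  moreover have "card ((U p \<union> U q) \<inter> U r) \<le> card (U p \<inter> U r) + card (U q \<inter> U r)"
    unfolding Int_Un_distrib2 by (rule card_Un_le)
  moreover have "card ((U p \<union> U q) \<union> U r) \<le> card (V - H)"
    by (rule card_mono) (use fin_V mem_U in auto)
  moreover have "card (V - H) = 2 * n - 1 - (2 * s - 1)"
    using H_sub card_V card_H fin_U by (simp add: card_Diff_subset)
  ultimately show False
    using card_U[OF assms(1)] card_U[OF assms(2)] card_U[OF assms(3)] n_large s_pos
      card_U_Un_Int[of p q] by linarith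
qed

text \<open>If the chain cannot be extended at its head \<open>p\<close>, no hub outside it is
  similar to \<open>p\<close>, so by \<open>sim_of_three\<close> those hubs are pairwise similar. As
  there are \<open>2 * s - 1\<close> hubs, enough of them remain to form the longer chain.\<close>

lemma sim_path:
  assumes "1 \<le> m" "m \<le> s"
  shows "\<exists>qs. distinct qs \<and> set qs \<subseteq> H \<and> length qs = m \<and> successively sim qs"
  using assms
proof (induction m rule: nat_induct_at_least)
  case base
  have "H \<noteq> {}" using card_H s_pos by auto
  then obtain h where "h \<in> H" by auto
  then show ?case by (intro exI[of _ "[h]"]) auto
next
  case (Suc m)
  then obtain qs where qs: "distinct qs" "set qs \<subseteq> H" "length qs = m" "successively sim qs" by auto
  then obtain p ps where p: "qs = p # ps" using Suc.hyps by (cases qs) auto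
  show ?case
  proof (cases "\<exists>h\<in>H - set qs. sim h p")
    case True
    then obtain h where "h \<in> H - set qs" "sim h p" by auto
    then show ?thesis using qs p by (intro exI[of _ "h # qs"]) auto
  next
    case False
    have "card (H - set qs) = 2 * s - 1 - m"
      using qs card_H by (simp add: card_Diff_subset distinct_card)
    then have "Suc m \<le> card (H - set qs)" using Suc by linarith
    then obtain K where K: "K \<subseteq> H - set qs" "card K = Suc m" by (meson obtain_subset_with_card_n)
    then have "finite K" using fin_U(2) finite_subset by blast
    then obtain rs where rs: "set rs = K" "distinct rs" using finite_distinct_list by blast
    have "sim x y" if "x \<in> K" "y \<in> K" "x \<noteq> y" for x y
    proof (rule sim_of_three[of p])
      show "\<not> sim p x" "\<not> sim p y" using False that K sim_sym by blast+
    qed (use that K qs p in auto)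
    then have "successively sim rs"
      using rs by (auto simp: successively_conv_nth nth_eq_iff_index_eq)
    then show ?thesis using rs K by (intro exI[of _ rs]) (auto simp: distinct_card)
  qed
qed

section \<open>Rearranging a chain of hubs\<close>

definition "heavy_cycle Q xs \<longleftrightarrow> distinct xs \<and> set xs = Q \<and> successively heavy xs \<and> heavy (last xs) (hd xs)"

lemma heavy_cycle_rotate: "heavy_cycle Q (xs @ ys) \<Longrightarrow> heavy_cycle Q (ys @ xs)"
  by (cases "xs = []"; cases "ys = []") (auto simp: heavy_cycle_def successively_append_iff)

context
  fixes Q assumes Q: "Q \<subseteq> H" "card Q = s"
begin

lemma heavy_ends:
  assumes "distinct qs" "set qs = Q" "successively sim qs"
  shows "heavy (hd qs) (last qs)"
  using linked_heavy[of qs] assms Q distinct_card[of qs] by auto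

lemma successively_heavy_sim:
  assumes "distinct qs" "set qs \<subseteq> H" "successively heavy qs"
  shows "successively sim qs"
  using assms by (induction qs rule: induct_list012) (auto intro: heavy_sim)

text \<open>The ends of a spanning chain are heavy and hence similar. Cutting the chain between two
  consecutive hubs and gluing the old ends gives another spanning chain, whose ends are those two
  hubs.\<close>

lemma heavy_cycle_exists: "\<exists>xs. heavy_cycle Q xs" if "distinct qs" "set qs = Q" "successively sim qs" for qs
proof -
  have qs: "length qs = s" using that Q distinct_card by metis
  then have ne: "qs \<noteq> []" using s_pos by auto
  have "heavy (qs ! i) (qs ! Suc i)" if i: "Suc i < length qs" for i
  proof -
    let ?xs = "drop (Suc i) qs" and ?ys = "take (Suc i) qs"
    have h: "heavy (hd qs) (last qs)" using heavy_ends \<open>distinct qs\<close> \<open>set qs = Q\<close> \<open>successively sim qs\<close> .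
    have "hd qs \<noteq> last qs" using \<open>distinct qs\<close> i ne
      by (simp add: hd_conv_nth last_conv_nth nth_eq_iff_index_eq)
    moreover have "hd qs \<in> H" "last qs \<in> H" using \<open>set qs = Q\<close> Q(1) ne by auto
    ultimately have "sim (last qs) (hd qs)" using heavy_sim[OF _ _ heavy_sym[OF h]] by simp
    moreover have "last ?xs = last qs" "hd ?ys = hd qs" "hd ?xs = qs ! Suc i"
      using i by (simp_all add: hd_drop_conv_nth)
    moreover have "last ?ys = qs ! i" using i by (simp add: take_Suc_conv_app_nth)
    moreover have "successively sim ?ys" "successively sim ?xs"
      using \<open>successively sim qs\<close> append_take_drop_id[of "Suc i" qs]
      by (metis successively_append_iff)+
    ultimately have "successively sim (?xs @ ?ys)" using i by (auto simp: successively_append_iff)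
    moreover have "distinct (?xs @ ?ys)"
      using \<open>distinct qs\<close> distinct_append[of ?ys ?xs] by (auto simp: Int_commute)
    moreover have "set (?xs @ ?ys) = Q"
      using \<open>set qs = Q\<close> set_append[of ?ys ?xs] by (auto simp: Un_commute)
    ultimately have "heavy (hd (?xs @ ?ys)) (last (?xs @ ?ys))" by (rule heavy_ends[rotated 2])
    then have "heavy (qs ! Suc i) (qs ! i)"
      using i ne \<open>hd ?xs = _\<close> \<open>last ?ys = _\<close> by (simp add: last_append)
    then show ?thesis by (rule heavy_sym)
  qed
  then have "successively heavy qs" by (simp add: successively_conv_nth)
  then have "heavy_cycle Q qs"
    using that(1,2) heavy_sym[OF heavy_ends[OF that]] by (simp add: heavy_cycle_def)
  then show ?thesis by (rule exI)
qed

text \<open>Two steps along a heavy cycle give a chord for \<open>sim\<close>, and with such a chord there is a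
  Hamiltonian \<open>sim\<close>-path between vertices at distance two.\<close>

lemma heavy_cycle_swap:
  assumes "heavy_cycle Q (x # y # zs)"
  shows "heavy_cycle Q (y # x # zs)"
proof (cases zs rule: rev_cases)
  case Nil
  then show ?thesis using assms heavy_sym by (auto simp: heavy_cycle_def)
next
  case (snoc ws w)
  show ?thesis
  proof (cases ws)
    case Nil
    then show ?thesis using assms snoc heavy_sym by (auto simp: heavy_cycle_def)
  next
    case (Cons z us)
    let ?us = "z # us"
    have zs: "zs = z # us @ [w]" using snoc Cons by simp
    have d: "distinct (x # y # z # us @ [w])" "set (x # y # z # us @ [w]) = Q"
      and hv: "heavy x y" "heavy y z" "heavy w x" "successively heavy (z # us @ [w])"
      using assms zs by (auto simp: heavy_cycle_def successively_Cons)
    then have inH: "x \<in> H" "y \<in> H" "z \<in> H" "w \<in> H" "set us \<subseteq> H" using Q by auto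
    have sus: "successively sim (z # us @ [w])"
      by (rule successively_heavy_sim) (use d hv inH in auto)
    have "sim x w" "sim w y" "sim y z"
      using d hv inH heavy_sim heavy_heavy_sim[of w x y] heavy_sym by auto
    have "heavy x z"
    proof -
      \<comment> \<open>From \<open>x\<close> the path runs backwards through \<open>w\<close> to
        the successor of \<open>z\<close>, then takes the chord over \<open>z\<close> to
        \<open>y\<close> and ends in \<open>z\<close>.\<close>
      let ?p = "x # rev (us @ [w]) @ [y, z]"
      have "hd (us @ [w]) \<in> H" "heavy z (hd (us @ [w]))" "hd (us @ [w]) \<noteq> y"
        using d hv inH by (cases us; auto)+
      then have "sim (hd (us @ [w])) y"
        using heavy_heavy_sim[of "hd (us @ [w])" z y] inH hv heavy_sym by auto
      moreover have "successively sim (us @ [w])" using sus by (cases us) auto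
      then have "successively sim (rev (us @ [w]))"
        using sim_sym by (subst successively_rev) (auto elim: successively_mono)
      moreover have "rev (us @ [w]) \<noteq> []" "hd (rev (us @ [w])) = w"
        "last (rev (us @ [w])) = hd (us @ [w])"
        by (simp_all add: last_rev)
      ultimately have "successively sim ?p"
        using \<open>sim x w\<close> \<open>sim y z\<close>
        unfolding successively_Cons successively_append_iff by (simp del: rev_append)
      then show ?thesis using heavy_ends[of ?p] d by auto
    qed
    moreover have "heavy w y"
    proof -
      \<comment> \<open>From \<open>y\<close> the path runs forwards to the predecessor of
        \<open>w\<close>, then takes the chord over \<open>w\<close> to \<open>x\<close> and ends in
        \<open>w\<close>.\<close>
      let ?p = "y # (z # us) @ [x, w]"
      have l: "last ?us \<in> H" "last ?us \<noteq> x" "heavy (last ?us) w"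
        using d hv inH successively_append_iff[of heavy ?us "[w]"] by auto
      then have "sim (last ?us) x" using heavy_heavy_sim[of "last ?us" w x] inH hv by auto
      moreover have "successively sim ?us" using sus successively_append_iff[of sim ?us "[w]"] by simp
      ultimately have "successively sim (?us @ [x, w])"
        using \<open>sim x w\<close> unfolding successively_append_iff by simp
      then have "successively sim ?p" using \<open>sim y z\<close> by simp
      then have "heavy y w" using heavy_ends[of ?p] d by auto
      then show ?thesis by (rule heavy_sym)
    qed
    ultimately show ?thesis
      using d hv heavy_sym zs unfolding heavy_cycle_def by (auto simp: successively_Cons)
  qed
qed

text \<open>Swaps of neighbours move \<open>y\<close> along the cycle until it stands next to
  \<open>x\<close>; the rotations bring the pair to be swapped to the front.\<close>

lemma heavy_cycle_adjacent:
  "heavy_cycle Q (x # as @ y # bs) \<Longrightarrow> heavy x y"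
proof (induction as arbitrary: bs rule: rev_induct)
  case Nil
  then show ?case by (auto simp: heavy_cycle_def)
next
  case (snoc u as)
  then have "heavy_cycle Q ((x # as) @ (u # y # bs))" by simp
  then have "heavy_cycle Q (u # y # bs @ x # as)" by (drule_tac heavy_cycle_rotate) simp
  then have "heavy_cycle Q ((y # u # bs) @ (x # as))" by (drule_tac heavy_cycle_swap) simp
  then have "heavy_cycle Q (x # as @ y # u # bs)" by (drule_tac heavy_cycle_rotate) simp
  then show ?case by (rule snoc.IH)
qed

lemma heavy_cycle_complete:
  assumes "heavy_cycle Q xs" "x \<in> Q" "y \<in> Q" "x \<noteq> y"
  shows "heavy x y"
proof -
  obtain as bs where "xs = as @ x # bs" using assms by (metis heavy_cycle_def split_list)
  then have c: "heavy_cycle Q (x # bs @ as)" using heavy_cycle_rotate[of Q as "x # bs"] assms(1) by simp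
  then have "y \<in> set (bs @ as)" using assms(3,4) by (auto simp: heavy_cycle_def)
  then obtain cs ds where "bs @ as = cs @ y # ds" by (meson split_list)
  then show ?thesis using c heavy_cycle_adjacent by metis
qed

end

lemma hub_clique: "\<exists>Q\<subseteq>H. card Q = s \<and> (\<forall>x\<in>Q. \<forall>y\<in>Q. x \<noteq> y \<longrightarrow> heavy x y)"
proof -
  obtain qs where qs: "distinct qs" "set qs \<subseteq> H" "length qs = s" "successively sim qs"
    using sim_path[of s] s_pos by auto
  then have Q: "card (set qs) = s" by (simp add: distinct_card)
  obtain xs where "heavy_cycle (set qs) xs"
    using heavy_cycle_exists[OF qs(2) Q] qs by blast
  then have "\<forall>x\<in>set qs. \<forall>y\<in>set qs. x \<noteq> y \<longrightarrow> heavy x y"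
    using heavy_cycle_complete[OF qs(2) Q] by blast
  then show ?thesis using qs Q by blast
qed

section \<open>Embedding the tree outside a large red clique\<close>

lemma hubs_contradiction: False
proof -
  obtain Q where Q: "Q \<subseteq> H" "card Q = s" and heavy: "\<And>x y. x \<in> Q \<Longrightarrow> y \<in> Q \<Longrightarrow> x \<noteq> y \<Longrightarrow> heavy x y"
    using hub_clique by blast
  have finQ: "finite Q" using Q(1) fin_U(2) finite_subset by blast
  have "s \<noteq> 1"
  proof
    assume s: "s = 1"
    then obtain p where p: "Q = {p}" using Q(2) card_1_singletonE by metis
    \<comment> \<open>A chain of one hub has equal ends, which bounds \<open>U p\<close> below
      \<open>n\<close>; but a hub has at least \<open>n + 2 - 2 * s = n\<close> such
      neighbours.\<close>
    have "heavy p p" using linked_heavy[of "[p]"] Q p s by auto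
    then show False using card_U[of p] Q p s by (auto simp: heavy_def)
  qed
  then have s2: "s \<ge> 2" using s_pos by simp
  then obtain e where e: "e \<in> Q" using Q(2) by fastforce
  have "card (Q - {e}) \<noteq> 0" using s2 Q(2) e finQ by simp
  then obtain f where f: "f \<in> Q" "e \<noteq> f" by (metis Diff_iff card.empty ex_in_conv insertI1)
  define Y where "Y = U e \<inter> U f"
  have Y_sub: "Y \<subseteq> V" "Y \<inter> H = {}" by (auto simp: Y_def mem_U)
  then have finY: "finite Y" using fin_sub by simp
  have YQ: "Y \<inter> Q = {}" using Y_sub(2) Q(1) by blast
  have cY: "n + 5 \<le> card Y + 4 * s"
    unfolding Y_def using heavy_inter heavy e f Q by blast
  have inH: "p \<in> H" if "p \<in> Q" for p using that Q(1) by auto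

  \<comment> \<open>Hubs of \<open>Q\<close> are pairwise heavy, so they may be chained in any
    order; only the two ends need to be prescribed.\<close>
  have through: "\<exists>qs. distinct qs \<and> set qs = insert p (insert q X) \<and> length qs = card X + 2
      \<and> hd qs = p \<and> last qs = q" if "finite X" "p \<notin> X" "q \<notin> X" "p \<noteq> q" for p q X
  proof -
    obtain ms where ms: "set ms = X" "distinct ms" using finite_distinct_list[OF \<open>finite X\<close>] by blast
    then show ?thesis
      using that distinct_card[of ms] by (intro exI[of _ "p # ms @ [q]"]) auto
  qed
  have path: "\<exists>zs. zs \<noteq> [] \<and> hd zs = hd qs \<and> last zs = last qs \<and> length zs + 1 = 2 * length qs
      \<and> distinct zs \<and> set zs \<subseteq> set qs \<union> (V - H - Fb) \<and> successively B zs"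
    if "qs \<noteq> []" "distinct qs" "set qs \<subseteq> Q" "finite Fb" "card Fb \<le> 4" for qs Fb
  proof (rule hub_path)
    have l: "length qs \<le> s" using that Q(2) finQ by (metis card_mono distinct_card)
    have "card Fb + length qs \<le> card (U (qs ! i) \<inter> U (qs ! Suc i)) + 1" if i: "Suc i < length qs" for i
    proof -
      have "qs ! i \<in> Q" "qs ! Suc i \<in> Q" "qs ! i \<noteq> qs ! Suc i"
        using i \<open>set qs \<subseteq> Q\<close> \<open>distinct qs\<close> by (auto simp: nth_eq_iff_index_eq)
      then have "n + 5 \<le> card (U (qs ! i) \<inter> U (qs ! Suc i)) + 4 * s"
        using heavy_inter heavy inH by blast
      then show ?thesis using l \<open>card Fb \<le> 4\<close> n_large s_pos by linarith
    qed
    then show "successively (\<lambda>p q. card Fb + length qs \<le> card (U p \<inter> U q) + 1) qs"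
      by (simp add: successively_conv_nth)
  qed (use that Q(1) in auto)
  have B_sym: "B y x" if "B x y" for x y using that sym_R by blast

  have Y_clique: "R x y" if "x \<in> Y" "y \<in> Y" "x \<noteq> y" for x y
  proof -
    have ins: "insert e (insert f (Q - {e, f})) = Q" using e f by auto
    have "card (Q - {e, f}) + 2 = s" using e f finQ Q(2) s2 by (simp add: card_Diff_subset)
    then obtain qs where qs: "distinct qs" "set qs = Q" "length qs = s" "hd qs = e" "last qs = f"
      using through[of "Q - {e, f}" e f] finQ f(2) unfolding ins by auto
    have "sim (qs ! i) (qs ! Suc i)" if i: "Suc i < length qs" for i
    proof -
      have "qs ! i \<in> Q" "qs ! Suc i \<in> Q" "qs ! i \<noteq> qs ! Suc i"
        using i qs by (auto simp: nth_eq_iff_index_eq)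
      then show ?thesis using heavy_sim heavy inH by blast
    qed
    then have "successively sim qs" by (simp add: successively_conv_nth)
    then show ?thesis
      using linked_joined[of qs x y] qs Q(1) that by (auto simp: Y_def)
  qed

  have two_attached: "R w w'"
    if w: "w \<in> V - Y - Q" "w' \<in> V - Y - Q" "w \<noteq> w'" and y: "y \<in> Y" "y' \<in> Y" "y \<noteq> y'"
      and nR: "\<not> R y w" "\<not> R y' w'" for w w' y y'
  proof (rule ccontr)
    assume nww: "\<not> R w w'"
    \<comment> \<open>With \<open>s - 1\<close> hubs the hub path has \<open>2 * s - 3\<close>
      vertices, leaving room for \<open>w\<close>, \<open>y\<close>, \<open>y'\<close> and
      \<open>w'\<close>. Its ends are \<open>e\<close> or \<open>f\<close> because \<open>Y\<close>
      lies in both of their neighbourhoods.\<close>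
    have "\<exists>qs. qs \<noteq> [] \<and> distinct qs \<and> set qs \<subseteq> Q \<and> length qs + 1 = s \<and> hd qs \<in> {e, f} \<and> last qs \<in> {e, f}"
    proof (cases "s = 2")
      case True
      then show ?thesis using e by (intro exI[of _ "[e]"]) auto
    next
      case False
      have "card (Q - {e, f}) + 2 = s" using e f finQ Q(2) s2 by (simp add: card_Diff_subset)
      then have c: "s - 3 \<le> card (Q - {e, f})" by simp
      then obtain X where X: "X \<subseteq> Q - {e, f}" "card X = s - 3" by (meson obtain_subset_with_card_n)
      then have "finite X" using finQ by (meson Diff_subset finite_subset subset_trans)
      then obtain qs where "distinct qs" "set qs = insert e (insert f X)" "length qs = card X + 2"
        "hd qs = e" "last qs = f"
        using through[of X e f] X f by auto
      then show ?thesis using X e f s2 False by (intro exI[of _ qs]) auto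
    qed
    then obtain qs where qs: "qs \<noteq> []" "distinct qs" "set qs \<subseteq> Q" "length qs + 1 = s"
      "hd qs \<in> {e, f}" "last qs \<in> {e, f}" by blast
    have "card {w, w', y, y'} \<le> 4" by (simp add: card_insert_if)
    then obtain zs where zs: "zs \<noteq> []" "hd zs = hd qs" "last zs = last qs" "length zs + 1 = 2 * length qs"
      "distinct zs" "set zs \<subseteq> set qs \<union> (V - H - {w, w', y, y'})" "successively B zs"
      using path[OF qs(1-3), of "{w, w', y, y'}"] by auto
    have "y \<in> U (hd qs)" "y' \<in> U (last qs)" using qs(5,6) y(1,2) by (auto simp: Y_def)
    then have "B y (hd zs)" "B (last zs) y'"
      using zs(2,3) B_sym[of "hd zs" y] by (simp_all add: mem_U)
    moreover have "B w y" "B y' w'" using w y nR B_sym[of y w] by auto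
    ultimately have "successively B (w # y # zs @ [y', w'])"
      using zs(1,7) unfolding successively_append_iff successively_Cons by simp
    moreover have "distinct (w # y # zs @ [y', w'])"
    proof -
      have "set zs \<inter> {w, w', y, y'} = {}" using zs(6) w y(1,2) qs(3) YQ by blast
      then show ?thesis using zs(5) w y by auto
    qed
    moreover have "set (w # y # zs @ [y', w']) \<subseteq> V" using zs(6) w y qs(3) Q(1) H_sub Y_sub by auto
    ultimately show False
      using no_cycle[of "w # y # zs @ [y', w']"] zs(4) qs(4) nww sym_R[of w' w] by auto
  qed

  have hub_attached: "R w p"
    if p: "p \<in> Q" and w: "w \<in> V - Y - Q" and y: "y \<in> Y" and nR: "\<not> R y w" for p w y
  proof (rule ccontr)
    assume nwp: "\<not> R w p"
    \<comment> \<open>The cycle consists of \<open>w\<close>, \<open>y\<close> and a hub path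
      through all of \<open>Q\<close> from \<open>g\<close> to \<open>p\<close>; it starts at
      \<open>e\<close> or \<open>f\<close> to be reachable from \<open>y\<close>.\<close>
    obtain g where g: "g \<in> {e, f}" "g \<noteq> p" using f(2) by auto
    then have gQ: "g \<in> Q" using e f by auto
    have ins: "insert g (insert p (Q - {g, p})) = Q" using p gQ by auto
    have "card (Q - {g, p}) + 2 = s" using p g(2) gQ finQ Q(2) s2 by (simp add: card_Diff_subset)
    then obtain qs where qs: "distinct qs" "set qs = Q" "length qs = s" "hd qs = g" "last qs = p"
      using through[of "Q - {g, p}" g p] finQ g(2) unfolding ins by auto
    have "card {w, y} \<le> 4" by (simp add: card_insert_if)
    moreover have "qs \<noteq> []" using qs(3) s2 by auto
    ultimately obtain zs where zs: "zs \<noteq> []" "hd zs = g" "last zs = p" "length zs + 1 = 2 * s"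
      "distinct zs" "set zs \<subseteq> Q \<union> (V - H - {w, y})" "successively B zs"
      using path[of qs "{w, y}"] qs by auto
    have "y \<in> U g" using g(1) y by (auto simp: Y_def)
    then have "B y g" using B_sym[of g y] by (simp add: mem_U)
    moreover have "B w y" using y w nR B_sym[of y w] by auto
    ultimately have "successively B (w # y # zs)" using zs(1,2,7) unfolding successively_Cons by simp
    moreover have "distinct (w # y # zs)"
    proof -
      have "set zs \<inter> {w, y} = {}" using zs(6) w y YQ by blast
      then show ?thesis using zs(5) w y by auto
    qed
    moreover have "set (w # y # zs) \<subseteq> V" using zs(6) w y Q(1) H_sub Y_sub by auto
    ultimately show False
      using no_cycle[of "w # y # zs"] zs(1,3,4) nwp sym_R[of p w] by auto
  qed

  define Z where "Z = {z \<in> V - Y. \<forall>y\<in>Y. R y z}"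
  define W where "W = V - Y - Z"
  \<comment> \<open>Elements of \<open>W\<close> have a blue neighbour in \<open>Y\<close>; for
    those in \<open>W1 y\<close> it can only be \<open>y\<close>.\<close>
  define W1 where "W1 y = {w \<in> W - Q. \<forall>y'\<in>Y. y' \<noteq> y \<longrightarrow> R y' w}" for y
  have finZW: "finite Z" "finite W" "finite (W1 y)" for y using fin_V by (auto simp: Z_def W_def W1_def)
  have sub: "Z \<subseteq> V" "W \<subseteq> V" "W1 y \<subseteq> W" for y by (auto simp: Z_def W_def W1_def)
  have dis: "Y \<inter> Z = {}" "Y \<inter> W = {}" "Z \<inter> W = {}" by (auto simp: Z_def W_def)
  have cW: "card W + card Y + card Z = 2 * n - 1"
  proof -
    have "V = W \<union> Y \<union> Z" using Y_sub sub by (auto simp: W_def)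
    then have "card V = card (W \<union> Y \<union> Z)" by simp
    also have "\<dots> = card W + card Y + card Z"
      using finZW finY dis by (subst card_Un_disjoint; (subst card_Un_disjoint)?) auto
    finally show ?thesis using card_V by simp
  qed
  \<comment> \<open>The extra \<open>1\<close> leaves room for deleting \<open>y\<close> from the
    clique in \<open>YZ1\<close>.\<close>
  have aY: "a + 1 \<le> card Y" using cY n_large col_small by linarith

  have YZ: "card Y + card Z < n"
  proof (rule ccontr)
    assume "\<not> card Y + card Z < n"
    moreover have "R x y" if "x \<in> Y" "y \<in> Y \<union> Z" "x \<noteq> y" for x y
      using that Y_clique by (auto simp: Z_def)
    ultimately show False using tree_in_clique_join[of Y Z] Y_sub sub dis aY by auto
  qed
  have YZ1: "card Y + card Z + card (W1 y) \<le> n" if "y \<in> Y" for y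
  proof (rule ccontr)
    assume big: "\<not> card Y + card Z + card (W1 y) \<le> n"
    have "Z \<inter> W1 y = {}" using dis sub by blast
    then have "card (Z \<union> W1 y) = card Z + card (W1 y)" using finZW by (intro card_Un_disjoint)
    moreover have "card (Y - {y}) + 1 = card Y" using that finY aY by simp
    ultimately have "n \<le> card (Y - {y}) + card (Z \<union> W1 y)" "a \<le> card (Y - {y})"
      using big aY by linarith+
    moreover have "R u v" if "u \<in> Y - {y}" "v \<in> Y - {y} \<union> (Z \<union> W1 y)" "u \<noteq> v" for u v
      using that Y_clique by (auto simp: Z_def W1_def)
    moreover have "(Y - {y}) \<inter> (Z \<union> W1 y) = {}" using dis sub by blast
    ultimately show False
      using tree_in_clique_join[of "Y - {y}" "Z \<union> W1 y"] Y_sub(1) sub(1) sub(2) sub(3)[of y] by blast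
  qed

  show False
  proof (rule tree_in_join[of "W - Q" "W \<inter> Q"])
    have un: "W - Q \<union> W \<inter> Q = W" by auto
    show "n \<le> card (W - Q \<union> W \<inter> Q)" unfolding un using cW YZ by linarith
    have "card W - card Q \<le> card (W - Q)" by (rule diff_card_le_card_Diff) (rule finQ)
    then show "a \<le> card (W - Q)" using cW YZ Q(2) col_small n_large s2 by linarith
    show "R w p" if wp: "w \<in> W - Q" "p \<in> W \<inter> Q" for w p
    proof -
      obtain y where "y \<in> Y" "\<not> R y w" using wp(1) by (auto simp: W_def Z_def)
      then show ?thesis using hub_attached[of p w y] wp by (auto simp: W_def)
    qed
    fix w assume w: "w \<in> W - Q"
    then obtain y where y: "y \<in> Y" "\<not> R y w" by (auto simp: W_def Z_def)
    have wV: "w \<in> V - Y - Q" using w by (auto simp: W_def)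
    \<comment> \<open>Unless both \<open>w\<close> and \<open>z\<close> lie in \<open>W1 y\<close>,
      distinct blue neighbours in \<open>Y\<close> can be chosen for them, and
      \<open>two_attached\<close> applies.\<close>
    have red: "R w z" if z: "z \<in> W" "z \<noteq> w" "w \<notin> W1 y \<or> z \<notin> W1 y" for z
    proof (cases "z \<in> Q")
      case True
      then show ?thesis using hub_attached[OF True wV y] by simp
    next
      case False
      then have zV: "z \<in> V - Y - Q" using z by (auto simp: W_def)
      obtain y' where y': "y' \<in> Y" "\<not> R y' z" using z(1) by (auto simp: W_def Z_def)
      consider y'' where "y'' \<in> Y" "y'' \<noteq> y" "\<not> R y'' w" | y'' where "y'' \<in> Y" "y'' \<noteq> y" "\<not> R y'' z"
        using z False w by (auto simp: W1_def)
      then show ?thesis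
      proof cases
        case 1
        then show ?thesis
          using two_attached[OF wV zV z(2)[symmetric], of y y'] two_attached[OF wV zV z(2)[symmetric], of y'' y']
            y y' by auto
      next
        case 2
        then show ?thesis using two_attached[OF wV zV z(2)[symmetric], of y y''] y by auto
      qed
    qed
    show "n \<le> card {z \<in> W - Q \<union> W \<inter> Q. z \<noteq> w \<and> R w z} + 1"
    proof (cases "w \<in> W1 y")
      case True
      have "card (W - W1 y) = card W - card (W1 y)"
        using sub finZW by (simp add: card_Diff_subset)
      moreover have "card (W - W1 y) \<le> card {z \<in> W - Q \<union> W \<inter> Q. z \<noteq> w \<and> R w z}"
        unfolding un by (rule card_mono) (use finZW red True in auto)
      ultimately show ?thesis using cW YZ1[OF y(1)] by linarith
    next
      case False
      have "card (W - {w}) \<le> card {z \<in> W - Q \<union> W \<inter> Q. z \<noteq> w \<and> R w z}"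
        unfolding un by (rule card_mono) (use finZW red False in auto)
      moreover have "card (W - {w}) + 1 = card W" using w finZW by (metis Diff_iff Suc_eq_plus1 card_Suc_Diff1)
      ultimately show ?thesis using cW YZ by linarith
    qed
  qed (use sub in auto)
qed

end

lemma (in tree_cycle) contradiction: False
proof -
  have "2 * s - 1 \<le> n" using n_large s_pos by linarith
  then obtain H where H: "H \<subseteq> V" "card H = 2 * s - 1"
      "\<forall>h\<in>H. n + 1 \<le> 2 * s - 1 + card {x \<in> V - H. B h x}"
    using hub_set by blast
  interpret hubs V R n s par col H
  proof unfold_locales
    fix h assume "h \<in> H"
    then show "n + 2 \<le> card {x \<in> V - H. B h x} + 2 * s" using H(3) s_pos by fastforce
  qed (use H in auto)
  show False by (rule hubs_contradiction)
qed

section \<open>Trees, cycles and the Ramsey number\<close>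

lemma contains_cycle:
  assumes "distinct xs" "length xs = k" "k > 0" "set xs \<subseteq> verts G"
    and succ: "successively (\<lambda>x y. {x, y} \<in> edges G) xs" and close: "{last xs, hd xs} \<in> edges G"
  shows "contains_subgraph G (cycle_graph k)"
proof -
  have "{xs ! i, xs ! (Suc i mod k)} \<in> edges G" if i: "i < k" for i
  proof (cases "Suc i < k")
    case True
    then show ?thesis using succ assms(2) by (auto simp: successively_conv_nth)
  next
    case False
    then have "Suc i = k" using i by simp
    moreover have "xs \<noteq> []" using assms(2,3) by auto
    ultimately have "xs ! i = last xs" "xs ! (Suc i mod k) = hd xs"
      using assms(2) by (auto simp: last_conv_nth hd_conv_nth)
    then show ?thesis using close by simp
  qed
  moreover have "inj_on ((!) xs) {..<k}" using assms(1,2) by (auto simp: inj_on_def nth_eq_iff_index_eq)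
  moreover have "(!) xs ` {..<k} \<subseteq> verts G" using assms(2,4) by auto
  ultimately show ?thesis unfolding contains_subgraph_def cycle_graph_def
    by (intro exI[of _ "(!) xs"]) auto
qed

text \<open>The tree is grown from a root along edges that leave the current set. By acyclicity a
  new vertex has only one neighbour in that set, so every edge is a parent edge.\<close>

lemma tree_enumeration:
  fixes T :: "'a ugraph"
  assumes T: "tree_graph T" and n: "card (verts T) = n"
  obtains t par where "bij_betw t {..<n} (verts T)" "\<forall>i. 0 < i \<longrightarrow> i < n \<longrightarrow> par i < i"
    "\<forall>e\<in>edges T. \<exists>i. 0 < i \<and> i < n \<and> e = {t i, t (par i)}"
proof -
  let ?E = "\<lambda>x y. {x, y} \<in> edges T"
  have fin: "finite (verts T)" and simple: "edges T \<subseteq> all_pairs (verts T)" and ne: "verts T \<noteq> {}"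
    and conn: "\<And>u v. u \<in> verts T \<Longrightarrow> v \<in> verts T \<Longrightarrow> ?E\<^sup>*\<^sup>* u v"
    and acyc: "\<And>m. m \<ge> 3 \<Longrightarrow> \<not> contains_subgraph T (cycle_graph m)"
    using T by (auto simp: tree_graph_def simple_graph_def connected_graph_def acyclic_graph_def)
  \<comment> \<open>Walks are free of repetitions, so that a new vertex adjacent to both ends of a
    walk closes it into a cycle.\<close>
  define walk where "walk S x y \<longleftrightarrow> (\<exists>xs. xs \<noteq> [] \<and> hd xs = x \<and> last xs = y \<and> distinct xs
      \<and> set xs \<subseteq> S \<and> successively ?E xs)" for S x y
  define inv where "inv m t par \<longleftrightarrow> inj_on t {..<m} \<and> t ` {..<m} \<subseteq> verts T
      \<and> (\<forall>i. 0 < i \<longrightarrow> i < m \<longrightarrow> par i < i)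
      \<and> (\<forall>e\<in>edges T. e \<subseteq> t ` {..<m} \<longrightarrow> (\<exists>i. 0 < i \<and> i < m \<and> e = {t i, t (par i)}))
      \<and> (\<forall>x\<in>t ` {..<m}. \<forall>y\<in>t ` {..<m}. walk (t ` {..<m}) x y)" for m and t :: "nat \<Rightarrow> 'a" and par :: "nat \<Rightarrow> nat"
  have n1: "1 \<le> n" using ne fin n by (metis One_nat_def Suc_leI card_gt_0_iff)
  have "\<exists>t par. inv m t par" if "1 \<le> m" "m \<le> n" for m
    using that
  proof (induction m rule: nat_induct_at_least)
    case base
    obtain r where r: "r \<in> verts T" using ne by auto
    have "\<not> e \<subseteq> {r}" if "e \<in> edges T" for e using that simple by (auto simp: all_pairs_def)
    moreover have "{..<1::nat} = {0}" by auto
    ultimately have "inv 1 (\<lambda>_. r) (\<lambda>_. 0)"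
      using r by (auto simp: inv_def walk_def intro!: exI[of _ "[r]"])
    then show ?case by blast
  next
    case (Suc m)
    then obtain t par where "inv m t par" by auto
    then have inj: "inj_on t {..<m}" and tv: "t ` {..<m} \<subseteq> verts T"
      and par: "\<And>i. 0 < i \<Longrightarrow> i < m \<Longrightarrow> par i < i"
      and edg: "\<And>e. e \<in> edges T \<Longrightarrow> e \<subseteq> t ` {..<m} \<Longrightarrow> \<exists>i. 0 < i \<and> i < m \<and> e = {t i, t (par i)}"
      and path: "\<And>x y. x \<in> t ` {..<m} \<Longrightarrow> y \<in> t ` {..<m} \<Longrightarrow> walk (t ` {..<m}) x y"
      by (auto simp: inv_def)
    let ?S = "t ` {..<m}"
    have "card ?S = m" using inj by (simp add: card_image)
    then have "?S \<noteq> verts T" using n Suc.prems by auto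
    then obtain v where v: "v \<in> verts T" "v \<notin> ?S" using tv by auto
    have r: "t 0 \<in> ?S" using Suc.hyps by auto
    have "\<exists>x\<in>?S. \<exists>u. u \<notin> ?S \<and> ?E x u"
    proof (rule ccontr)
      assume neg: "\<not> ?thesis"
      have "y \<in> ?S" if "?E\<^sup>*\<^sup>* (t 0) y" for y
        using that by induction (use neg r in blast)+
      then show False using conn[of "t 0" v] v r tv by blast
    qed
    then obtain j u where j: "j < m" and u: "u \<notin> ?S" "?E (t j) u" by auto
    have uv: "u \<in> verts T" using u(2) simple by (auto simp: all_pairs_def doubleton_eq_iff)
    have uniq: "z = t j" if z: "z \<in> ?S" "?E u z" for z
    proof (rule ccontr)
      assume zj: "z \<noteq> t j"
      obtain xs where xs: "xs \<noteq> []" "hd xs = t j" "last xs = z" "distinct xs" "set xs \<subseteq> ?S" "successively ?E xs"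
        using path[of "t j" z] j z by (auto simp: walk_def)
      have "length xs \<noteq> 1" using xs(1-3) zj by (metis hd_conv_nth last_conv_nth One_nat_def diff_self_eq_0)
      then have "length xs \<ge> 2" using xs(1) by (cases xs rule: remdups_adj.cases) auto
      then have "contains_subgraph T (cycle_graph (Suc (length xs)))"
        using xs u uv z tv
        by (intro contains_cycle[of "u # xs"]) (auto simp: successively_Cons insert_commute)
      then show False using acyc[of "Suc (length xs)"] \<open>length xs \<ge> 2\<close> by simp
    qed
    let ?t = "t(m := u)" and ?par = "par(m := j)"
    have im: "?t ` {..<Suc m} = insert u ?S" by (auto simp: lessThan_Suc)
    have "\<exists>i. 0 < i \<and> i < Suc m \<and> e = {?t i, ?t (?par i)}"
      if e: "e \<in> edges T" "e \<subseteq> insert u ?S" for e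
    proof (cases "u \<in> e")
      case True
      obtain x y where "e = {x, y}" "x \<noteq> y" using e(1) simple by (auto simp: all_pairs_def)
      then obtain z where z: "e = {u, z}" "z \<noteq> u" using True by (metis doubleton_eq_iff insert_iff singletonD)
      then have "z = t j" using uniq e by auto
      then show ?thesis using z j Suc.hyps by (intro exI[of _ m]) auto
    next
      case False
      then obtain i where i: "0 < i" "i < m" "e = {t i, t (par i)}" using edg e by blast
      then show ?thesis using par[of i] by (intro exI[of _ i]) auto
    qed
    moreover have "walk (insert u ?S) x y" if xy: "x \<in> insert u ?S" "y \<in> insert u ?S" for x y
    proof -
      have tj: "t j \<in> ?S" using j by auto
      consider "x = u" "y = u" | "x = u" "y \<in> ?S" | "x \<in> ?S" "y = u" | "x \<in> ?S" "y \<in> ?S" using xy by auto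
      then show ?thesis
      proof cases
        case 1
        then show ?thesis unfolding walk_def by (intro exI[of _ "[u]"]) auto
      next
        case 2
        then obtain xs where "xs \<noteq> []" "hd xs = t j" "last xs = y" "distinct xs" "set xs \<subseteq> ?S" "successively ?E xs"
          using path[OF tj] unfolding walk_def by blast
        then show ?thesis using 2 u unfolding walk_def
          by (intro exI[of _ "u # xs"]) (auto simp: successively_Cons insert_commute)
      next
        case 3
        then obtain xs where "xs \<noteq> []" "hd xs = x" "last xs = t j" "distinct xs" "set xs \<subseteq> ?S" "successively ?E xs"
          using path[OF _ tj] unfolding walk_def by blast
        then show ?thesis using 3 u unfolding walk_def
          by (intro exI[of _ "xs @ [u]"]) (auto simp: successively_append_iff)
      next
        case 4
        then show ?thesis using path[of x y] unfolding walk_def by blast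
      qed
    qed
    moreover have "inj_on ?t {..<Suc m}" using inj u(1) by (auto simp: lessThan_Suc inj_on_def)
    moreover have "\<And>i. 0 < i \<Longrightarrow> i < Suc m \<Longrightarrow> ?par i < i" using par j by (auto simp: less_Suc_eq)
    ultimately have "inv (Suc m) ?t ?par" unfolding inv_def im using tv uv by blast
    then show ?case by blast
  qed
  then obtain t par where inv: "inv n t par" using n1 by blast
  then have "card (t ` {..<n}) = n" by (simp add: inv_def card_image)
  then have im: "t ` {..<n} = verts T" using inv fin n by (metis inv_def card_subset_eq)
  have "e \<subseteq> verts T" if "e \<in> edges T" for e using that simple by (auto simp: all_pairs_def)
  then show ?thesis using that[of t par] inv im by (simp add: inv_def bij_betw_def)
qed

text \<open>Parents precede their children, so colours can be assigned in order; negating the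
  colouring makes the marked class the smaller one.\<close>

lemma parent_coloring:
  fixes par :: "nat \<Rightarrow> nat"
  assumes "\<forall>i. 0 < i \<longrightarrow> i < n \<longrightarrow> par i < i"
  obtains col :: "nat \<Rightarrow> bool" where "\<forall>i. 0 < i \<longrightarrow> i < n \<longrightarrow> col i \<noteq> col (par i)"
    "2 * card {i. i < n \<and> col i} \<le> n"
proof -
  define proper where "proper m col \<longleftrightarrow> (\<forall>i. 0 < i \<longrightarrow> i < m \<longrightarrow> col i \<noteq> col (par i))"
    for m and col :: "nat \<Rightarrow> bool"
  have "\<exists>col. proper m col" if "m \<le> n" for m
    using that
  proof (induction m)
    case 0
    show ?case by (simp add: proper_def)
  next
    case (Suc m)
    then obtain col where col: "proper m col" by auto
    have "proper (Suc m) (col(m := \<not> col (par m)))"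
      unfolding proper_def
    proof (intro allI impI)
      fix i assume i: "0 < i" "i < Suc m"
      then have "par i < i" using assms Suc.prems by simp
      then show "(col(m := \<not> col (par m))) i \<noteq> (col(m := \<not> col (par m))) (par i)"
        using col i by (cases "i = m") (auto simp: proper_def)
    qed
    then show ?case by blast
  qed
  then obtain col where col: "proper n col" by blast
  have "{..<n} = {i. i < n \<and> col i} \<union> {i. i < n \<and> \<not> col i}" by auto
  then have "card {..<n} = card ({i. i < n \<and> col i} \<union> {i. i < n \<and> \<not> col i})" by metis
  also have "\<dots> = card {i. i < n \<and> col i} + card {i. i < n \<and> \<not> col i}"
    by (rule card_Un_disjoint) auto
  finally have sum: "n = card {i. i < n \<and> col i} + card {i. i < n \<and> \<not> col i}" by simp
  show ?thesis
  proof (cases "2 * card {i. i < n \<and> col i} \<le> n")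
    case True
    then show ?thesis using that[of col] col by (simp add: proper_def)
  next
    case False
    then have "2 * card {i. i < n \<and> \<not> col i} \<le> n" using sum by linarith
    then show ?thesis using that[of "\<lambda>i. \<not> col i"] col by (simp add: proper_def)
  qed
qed

lemma ramsey_upper:
  fixes \<Gamma> :: "'v ugraph" and T :: "'a ugraph"
  assumes k: "k \<ge> 3" "odd k" and nk: "n \<ge> 4 * k - 8"
    and T: "tree_graph T" "card (verts T) = n"
    and G: "simple_graph \<Gamma>" "card (verts \<Gamma>) = 2 * n - 1"
  shows "contains_subgraph \<Gamma> T \<or> contains_subgraph (complement_graph \<Gamma>) (cycle_graph k)"
proof (rule ccontr)
  assume neg: "\<not> ?thesis"
  obtain t par where t: "bij_betw t {..<n} (verts T)" and par: "\<forall>i. 0 < i \<longrightarrow> i < n \<longrightarrow> par i < i"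
    and edg: "\<forall>e\<in>edges T. \<exists>i. 0 < i \<and> i < n \<and> e = {t i, t (par i)}"
    by (rule tree_enumeration[OF T])
  obtain col where col: "\<forall>i. 0 < i \<longrightarrow> i < n \<longrightarrow> col i \<noteq> col (par i)"
    "2 * card {i. i < n \<and> col i} \<le> n"
    by (rule parent_coloring[OF par])
  \<comment> \<open>With \<open>k = 2 * s + 1\<close> the bound on \<open>n\<close> becomes
    \<open>n + 4 \<ge> 8 * s\<close>.\<close>
  define s where "s = k div 2"
  have ks: "k = 2 * s + 1" using k(2) by (simp add: s_def)
  let ?R = "\<lambda>x y. {x, y} \<in> edges \<Gamma>"
  have "tree_cycle (verts \<Gamma>) ?R n s par col"
  proof
    show "finite (verts \<Gamma>)" using G by (simp add: simple_graph_def)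
    show "s \<ge> 1" "n + 4 \<ge> 8 * s" using k nk ks by auto
    show "?R y x" if "?R x y" for x y using that by (simp add: insert_commute)
    fix g :: "nat \<Rightarrow> 'v"
    assume g: "inj_on g {..<n}" "g ` {..<n} \<subseteq> verts \<Gamma>" "\<And>i. 0 < i \<Longrightarrow> i < n \<Longrightarrow> ?R (g i) (g (par i))"
    let ?h = "the_inv_into {..<n} t"
    have h: "inj_on ?h (verts T)" "?h ` verts T = {..<n}"
      using bij_betw_the_inv_into[OF t] by (simp_all add: bij_betw_def)
    have ht: "?h (t i) = i" if "i < n" for i using that t by (simp add: bij_betw_def the_inv_into_f_f)
    have "(g \<circ> ?h) ` e \<in> edges \<Gamma>" if "e \<in> edges T" for e
    proof -
      obtain i where i: "0 < i" "i < n" "e = {t i, t (par i)}" using edg \<open>e \<in> edges T\<close> by blast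
      moreover have "par i < n" using i par by (meson less_trans)
      ultimately have "(g \<circ> ?h) ` e = {g i, g (par i)}" using ht by simp
      then show ?thesis using g(3) i by simp
    qed
    moreover have "inj_on (g \<circ> ?h) (verts T)" using h g(1) by (simp add: comp_inj_on)
    moreover have "(g \<circ> ?h) ` verts T \<subseteq> verts \<Gamma>" using h(2) g(2) by (metis image_comp)
    ultimately have "contains_subgraph \<Gamma> T" unfolding contains_subgraph_def by blast
    then show False using neg by simp
  next
    fix xs
    assume xs: "set xs \<subseteq> verts \<Gamma>" "distinct xs" "length xs = 2 * s + 1"
      "successively (\<lambda>x y. x \<noteq> y \<and> \<not> ?R x y) xs" "\<not> ?R (last xs) (hd xs)"
    have comp: "{x, y} \<in> edges (complement_graph \<Gamma>)"
      if "x \<in> verts \<Gamma>" "y \<in> verts \<Gamma>" "x \<noteq> y" "\<not> ?R x y" for x y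
      using that by (auto simp: complement_graph_def all_pairs_def)
    have ne: "xs \<noteq> []" using xs(3) by auto
    have "length xs \<ge> 3" using xs(3) ks k(1) by simp
    then have "last xs \<noteq> hd xs" using xs(2) ne
      by (simp add: last_conv_nth hd_conv_nth nth_eq_iff_index_eq)
    moreover have "last xs \<in> verts \<Gamma>" "hd xs \<in> verts \<Gamma>" using xs(1) ne by auto
    ultimately have "{last xs, hd xs} \<in> edges (complement_graph \<Gamma>)" using comp xs(5) by blast
    moreover have "successively (\<lambda>x y. {x, y} \<in> edges (complement_graph \<Gamma>)) xs"
      by (rule successively_mono[OF xs(4)]) (use xs(1) comp in blast)
    ultimately have "contains_subgraph (complement_graph \<Gamma>) (cycle_graph k)"
      using xs(1-3) ks by (intro contains_cycle[of xs]) (auto simp: complement_graph_def)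
    then show False using neg by simp
  qed (use par col G in auto)
  then show False by (rule tree_cycle.contradiction)
qed

text \<open>The host consists of two cliques with at most \<open>n - 1\<close> vertices each, too
  small for the connected \<open>T\<close>; its complement is bipartite and so has no odd cycle.
  Every \<open>M\<close> below the bound is treated, as the least number requires.\<close>

lemma ramsey_lower:
  fixes T :: "'a ugraph"
  assumes T: "connected_graph T" "card (verts T) = n" and "n \<ge> 1" "M < 2 * n - 1" and "odd k"
  shows "\<exists>\<Gamma> :: nat ugraph. simple_graph \<Gamma> \<and> card (verts \<Gamma>) = M \<and> \<not> contains_subgraph \<Gamma> T
    \<and> \<not> contains_subgraph (complement_graph \<Gamma>) (cycle_graph k)"
proof -
  define side where "side x \<longleftrightarrow> x < n - 1" for x :: nat
  define \<Gamma> where "\<Gamma> = UGraph {..<M} {{x, y} | x y. x < M \<and> y < M \<and> x \<noteq> y \<and> side x = side y}"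
  have "simple_graph \<Gamma>" by (auto simp: \<Gamma>_def simple_graph_def all_pairs_def)
  moreover have "card (verts \<Gamma>) = M" by (simp add: \<Gamma>_def)
  moreover have "\<not> contains_subgraph \<Gamma> T"
  proof
    assume "contains_subgraph \<Gamma> T"
    then obtain f where f: "inj_on f (verts T)" "f ` verts T \<subseteq> {..<M}" "\<And>e. e \<in> edges T \<Longrightarrow> f ` e \<in> edges \<Gamma>"
      by (auto simp: contains_subgraph_def \<Gamma>_def)
    obtain r where r: "r \<in> verts T" using T(1) by (auto simp: connected_graph_def)
    have step: "side (f u) = side (f v)" if "{u, v} \<in> edges T" for u v
      using f(3)[OF that] by (auto simp: \<Gamma>_def doubleton_eq_iff)
    have same: "side (f v) = side (f r)" if "v \<in> verts T" for v
    proof -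
      have "(\<lambda>x y. {x, y} \<in> edges T)\<^sup>*\<^sup>* r v" using T(1) r that by (simp add: connected_graph_def)
      then show ?thesis by induction (use step in auto)
    qed
    have "card (f ` verts T) = n" using f(1) T(2) by (simp add: card_image)
    moreover have "f ` verts T \<subseteq> {..<n - 1} \<or> f ` verts T \<subseteq> {n - 1..<M}"
      using same f(2) by (cases "side (f r)") (auto simp: side_def not_less)
    then have "card (f ` verts T) \<le> n - 1 \<or> card (f ` verts T) \<le> M - (n - 1)"
      by (metis card_mono finite_lessThan finite_atLeastLessThan card_lessThan card_atLeastLessThan)
    ultimately show False using assms(3,4) by linarith
  qed
  moreover have "\<not> contains_subgraph (complement_graph \<Gamma>) (cycle_graph k)"
  proof
    assume "contains_subgraph (complement_graph \<Gamma>) (cycle_graph k)"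
    then obtain f where f: "\<forall>e\<in>edges (cycle_graph k). f ` e \<in> edges (complement_graph \<Gamma>)"
      unfolding contains_subgraph_def by blast
    have step: "side (f i) \<noteq> side (f (Suc i mod k))" if "i < k" for i
    proof
      assume eq: "side (f i) = side (f (Suc i mod k))"
      have "{i, Suc i mod k} \<in> edges (cycle_graph k)" using that by (auto simp: cycle_graph_def)
      then have "f ` {i, Suc i mod k} \<in> edges (complement_graph \<Gamma>)" using f by blast
      then have e: "{f i, f (Suc i mod k)} \<in> all_pairs {..<M}" "{f i, f (Suc i mod k)} \<notin> edges \<Gamma>"
        by (simp_all add: complement_graph_def \<Gamma>_def)
      then have "f i < M" "f (Suc i mod k) < M" "f i \<noteq> f (Suc i mod k)"
        by (auto simp: all_pairs_def doubleton_eq_iff)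
      then show False using e(2) eq by (auto simp: \<Gamma>_def)
    qed
    \<comment> \<open>Sides alternate along the cycle; as \<open>k\<close> is odd, its last index is
      even, and the closing edge would stay on one side.\<close>
    have alt: "side (f i) = (side (f 0) = even i)" if "i < k" for i
      using that
    proof (induction i)
      case (Suc i)
      then show ?case using step[of i] by auto
    qed simp
    obtain j where j: "k = Suc j" "even j" using assms(5) by (cases k) auto
    then have "side (f j) = side (f 0)" using alt[of j] by simp
    moreover have "side (f j) \<noteq> side (f 0)" using step[of j] j(1) by simp
    ultimately show False by simp
  qed
  ultimately show ?thesis by blast
qed

theorem theorem1p4:
  fixes k n :: nat and T :: "'a ugraph"
  assumes "k \<ge> 3" and "odd k"
    and "n \<ge> 4 * k - 8"
    and "tree_graph T" and "card (verts T) = n"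
  shows "ramsey_number T (cycle_graph k) = 2 * n - 1"
  unfolding ramsey_number_def
proof (rule Least_equality)
  show "0 < 2 * n - 1 \<and> (\<forall>\<Gamma> :: nat ugraph. simple_graph \<Gamma> \<and> card (verts \<Gamma>) = 2 * n - 1 \<longrightarrow>
      contains_subgraph \<Gamma> T \<or> contains_subgraph (complement_graph \<Gamma>) (cycle_graph k))"
    using ramsey_upper[OF assms] assms(1,3) by auto
next
  fix M
  assume M: "0 < M \<and> (\<forall>\<Gamma> :: nat ugraph. simple_graph \<Gamma> \<and> card (verts \<Gamma>) = M \<longrightarrow>
      contains_subgraph \<Gamma> T \<or> contains_subgraph (complement_graph \<Gamma>) (cycle_graph k))"
  show "2 * n - 1 \<le> M"
  proof (rule ccontr)
    assume "\<not> ?thesis"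
    moreover have "n \<ge> 1" using assms(1,3) by simp
    ultimately show False
      using ramsey_lower[of T n M k] M assms(2,4,5) by (auto simp: tree_graph_def not_le)
  qed
qed

end
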